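(* Let $H$ be a connected graph on at least three vertices which contains a cycle, and let $t\geq e(H)$ be an integer. Then \[\operatorname{sat}_t(n,\mathfrak{R}(H))\leq (1+o_H(1))\,c_H\cdot n\log n,\quad\text{where } c_H=2e(H)(|H|-2),\] and $o_H(1)$ denotes a quantity tending to $0$ as $n\to\infty$ (depending on $H$).
   Context: A $t$-edge-coloured graph is a graph $G$ with a function $c:E(G)\to\{1,\dots,t\}$ (not necessarily proper). A copy of $H$ is rainbow if all its edges receive distinct colours; $\mathfrak{R}(H)$ denotes the family of rainbow copies of $H$. A $t$-edge-coloured graph is $\mathfrak{R}(H)$-saturated if it contains no rainbow copy of $H$ but adding any non-edge in any colour from $\{1,\dots,t\}$ creates a rainbow copy of $H$. $\operatorname{sat}_t(n,\mathfrak{R}(H))$ is the minimum number of edges of such a graph on $n$ vertices. Logarithms are base 2. *)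

theory Defs
  imports Complex_Main
begin

type_synonym 'a graph = "'a set \<times> 'a set set"

abbreviation verts :: "'a graph \<Rightarrow> 'a set" where "verts \<equiv> fst"
abbreviation edges :: "'a graph \<Rightarrow> 'a set set" where "edges \<equiv> snd"

definition simple_graph :: "'a graph \<Rightarrow> bool" where
  "simple_graph G \<longleftrightarrow> finite (verts G) \<and> (\<forall>e\<in>edges G. e \<subseteq> verts G \<and> card e = 2)"

definition connected_graph :: "'a graph \<Rightarrow> bool" where
  "connected_graph G \<longleftrightarrow> verts G \<noteq> {} \<and>
     (\<forall>u\<in>verts G. \<forall>v\<in>verts G. (u, v) \<in> {(x, y). {x, y} \<in> edges G}\<^sup>*)"

definition contains_cycle :: "'a graph \<Rightarrow> bool" where
  "contains_cycle G \<longleftrightarrow> (\<exists>vs. length vs \<ge> 3 \<and> distinct vs \<and> set vs \<subseteq> verts G \<and>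
     (\<forall>i<length vs. {vs ! i, vs ! (Suc i mod length vs)} \<in> edges G))"

definition subgraph :: "'a graph \<Rightarrow> 'a graph \<Rightarrow> bool" where
  "subgraph F G \<longleftrightarrow> simple_graph F \<and> verts F \<subseteq> verts G \<and> edges F \<subseteq> edges G"

definition graph_iso :: "'a graph \<Rightarrow> 'b graph \<Rightarrow> bool" where
  "graph_iso G G' \<longleftrightarrow> (\<exists>f. bij_betw f (verts G) (verts G') \<and>
     (\<forall>u\<in>verts G. \<forall>v\<in>verts G. {u, v} \<in> edges G \<longleftrightarrow> {f u, f v} \<in> edges G'))"

text \<open>A copy of \<open>H\<close> in \<open>G\<close> is a subgraph, not necessarily induced, that is isomorphic to \<open>H\<close>.\<close>
definition has_rainbow_copy :: "'a graph \<Rightarrow> 'b graph \<Rightarrow> ('b set \<Rightarrow> nat) \<Rightarrow> bool" where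
  "has_rainbow_copy H G c \<longleftrightarrow> (\<exists>F. subgraph F G \<and> graph_iso H F \<and> inj_on c (edges F))"

text \<open>Only the values of the colouring on the edges of \<open>G\<close> matter.\<close>
definition edge_coloured_graph :: "nat \<Rightarrow> 'b graph \<Rightarrow> ('b set \<Rightarrow> nat) \<Rightarrow> bool" where
  "edge_coloured_graph t G c \<longleftrightarrow> simple_graph G \<and> (\<forall>e\<in>edges G. c e \<in> {1..t})"

definition rainbow_saturated :: "nat \<Rightarrow> 'a graph \<Rightarrow> 'b graph \<Rightarrow> ('b set \<Rightarrow> nat) \<Rightarrow> bool" where
  "rainbow_saturated t H G c \<longleftrightarrow>
     edge_coloured_graph t G c \<and> \<not> has_rainbow_copy H G c \<and>
     (\<forall>u\<in>verts G. \<forall>v\<in>verts G. u \<noteq> v \<longrightarrow> {u, v} \<notin> edges G \<longrightarrow>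
        (\<forall>i\<in>{1..t}. has_rainbow_copy H (verts G, insert {u, v} (edges G)) (c({u, v} := i))))"

text \<open>Every finite graph is isomorphic to one with vertices in \<open>nat\<close>, so the host graphs may be
  taken over \<open>nat\<close>. The minimum is an infimum in \<open>nat\<close>; it is attained whenever \<open>H\<close> has at least
  two edges and \<open>t \<ge> 1\<close>, see \<open>sat_attained\<close>.\<close>
definition sat :: "nat \<Rightarrow> nat \<Rightarrow> 'a graph \<Rightarrow> nat" where
  "sat t n H = Inf {card (edges G) | (G :: nat graph) c.
     card (verts G) = n \<and> rainbow_saturated t H G c}"

lemma sat_attained:
  fixes H :: "'a graph"
  assumes H: "simple_graph H" "card (edges H) \<ge> 2" and t: "t \<ge> 1"
  shows "\<exists>(G :: nat graph) c. card (verts G) = n \<and> rainbow_saturated t H G c \<and>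
           card (edges G) = sat t n H"
proof -
  define G :: "nat graph" where "G = ({..<n}, {e. e \<subseteq> {..<n} \<and> card e = 2})"
  define c where "c = (\<lambda>e :: nat set. 1 :: nat)"
  obtain e1 e2 where e: "e1 \<in> edges H" "e2 \<in> edges H" "e1 \<noteq> e2"
    using H(2) by (metis card_le_Suc0_iff_eq card.infinite not_less_eq_eq numeral_2_eq_2
        zero_le)
  have "\<not> has_rainbow_copy H G c"
  proof
    assume "has_rainbow_copy H G c"
    then obtain F f where F: "inj_on c (edges F)" and f: "bij_betw f (verts H) (verts F)"
      and ff: "\<And>u v. u \<in> verts H \<Longrightarrow> v \<in> verts H \<Longrightarrow> {u, v} \<in> edges H \<longleftrightarrow> {f u, f v} \<in> edges F"
      unfolding has_rainbow_copy_def graph_iso_def by blast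
    have im: "f ` e \<in> edges F" if "e \<in> edges H" for e
    proof -
      obtain u v where uv: "e = {u, v}" "u \<in> verts H" "v \<in> verts H"
        using H(1) \<open>e \<in> edges H\<close> unfolding simple_graph_def
        by (metis card_2_iff insert_subset)
      then show ?thesis using ff that by auto
    qed
    have "f ` e1 = f ` e2"
      using F im[OF e(1)] im[OF e(2)] by (auto simp: inj_on_def c_def)
    moreover have "e1 \<subseteq> verts H" "e2 \<subseteq> verts H" "inj_on f (verts H)"
      using H(1) e f by (auto simp: simple_graph_def bij_betw_def)
    ultimately have "e1 = e2" by (metis inj_on_image_eq_iff)
    with e(3) show False by blast
  qed
  then have "rainbow_saturated t H G c" "card (verts G) = n"
    using t by (auto simp: rainbow_saturated_def edge_coloured_graph_def simple_graph_def
        G_def c_def)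
  then have "{card (edges G) | (G :: nat graph) c.
     card (verts G) = n \<and> rainbow_saturated t H G c} \<noteq> {}" by blast
  from Inf_nat_def1[OF this] show ?thesis
    unfolding sat_def[symmetric] mem_Collect_eq by metis
qed

end

theory Submission
  imports Defs
begin

text \<open>
  Choose an edge \<open>ab\<close> of \<open>H\<close> such that \<open>deg a + deg b - 1\<close> exceeds the maximum degree, and number the
  edges of \<open>H\<close> by \<open>1..m\<close> with \<open>ab\<close> getting 1. The host graph has a core of blocks indexed by a kind
  \<open>i \<le> m\<close> and a bit position \<open>s < L\<close>, where \<open>n \<le> 2 ^ L\<close>; each block is a copy of \<open>H - {a, b}\<close>. All
  other vertices are independent, and such a vertex \<open>x\<close> is joined to the block \<open>(i, s)\<close> as if it were
  \<open>a\<close> or \<open>b\<close>, according to bit \<open>s\<close> of \<open>x\<close>. An edge playing the role of the \<open>l\<close>-th edge of \<open>H\<close> is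
  coloured \<open>l\<close>, except that in blocks of kind \<open>l\<close> it is coloured 1. So colour \<open>i\<close> is missing from the
  blocks of kind \<open>i\<close>, and adding an edge between two outer vertices in any colour completes a rainbow
  copy of \<open>H\<close> in a block where their bits differ.

  There is no rainbow copy to begin with: it would use every colour in \<open>1..m\<close>, so every role except
  \<open>ab\<close>, and one role twice, in two different blocks. Counting vertices leaves room for only one outer
  vertex, which then carries all edges with a role at \<open>a\<close> or \<open>b\<close> and the repeated one, that is
  \<open>deg a + deg b - 1\<close> edges, too many for a vertex of \<open>H\<close>.

  Completing the colouring greedily only adds edges that meet the core, so at most \<open>n\<close> times the size
  \<open>(|H| - 2) m L\<close> of the core edges result, and the error term can be taken to be zero.
\<close>

section \<open>Rainbow copies as injective maps\<close>

definition rainbow_embedding :: "('a \<Rightarrow> 'b) \<Rightarrow> 'a graph \<Rightarrow> 'b graph \<Rightarrow> ('b set \<Rightarrow> nat) \<Rightarrow> bool" where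
  "rainbow_embedding f H G c \<longleftrightarrow> inj_on f (verts H) \<and> f ` verts H \<subseteq> verts G \<and>
     (\<forall>e\<in>edges H. f ` e \<in> edges G) \<and> inj_on (\<lambda>e. c (f ` e)) (edges H)"

lemma simple_graph_edgeE:
  assumes "simple_graph G" "e \<in> edges G"
  obtains u v where "e = {u, v}" "u \<noteq> v" "u \<in> verts G" "v \<in> verts G"
  using assms unfolding simple_graph_def by (metis card_2_iff insert_subset)

lemma card_edge: "simple_graph G \<Longrightarrow> e \<in> edges G \<Longrightarrow> card e = 2"
  by (simp add: simple_graph_def)

lemma finite_edges: "simple_graph G \<Longrightarrow> finite (edges G)"
  by (rule finite_subset[of _ "Pow (verts G)"]) (auto simp: simple_graph_def)

text \<open>Given an embedding, the copy is taken with exactly the images of the edges of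
  \<open>H\<close>, so it is isomorphic to \<open>H\<close> even if the host has further edges
  between its vertices.\<close>

lemma has_rainbow_copy_iff:
  assumes H: "simple_graph H"
  shows "has_rainbow_copy H G c \<longleftrightarrow> (\<exists>f. rainbow_embedding f H G c)"
proof
  assume "has_rainbow_copy H G c"
  then obtain F f where F: "subgraph F G" "inj_on c (edges F)" and f: "bij_betw f (verts H) (verts F)"
    and ff: "\<And>u v. u \<in> verts H \<Longrightarrow> v \<in> verts H \<Longrightarrow> {u, v} \<in> edges H \<longleftrightarrow> {f u, f v} \<in> edges F"
    unfolding has_rainbow_copy_def graph_iso_def by blast
  have im: "f ` e \<in> edges F" if e: "e \<in> edges H" for e
  proof -
    obtain u v where "e = {u, v}" "u \<in> verts H" "v \<in> verts H"
      by (rule simple_graph_edgeE[OF H e])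
    then show ?thesis using ff e by simp
  qed
  have inj: "inj_on f (verts H)" using f by (simp add: bij_betw_def)
  have "edges H \<subseteq> Pow (verts H)" using H by (auto simp: simple_graph_def)
  then have "inj_on ((`) f) (edges H)" by (rule inj_on_subset[OF inj_on_image_Pow[OF inj]])
  moreover have "(`) f ` edges H \<subseteq> edges F" using im by blast
  ultimately have "inj_on (c \<circ> (`) f) (edges H)"
    by (rule comp_inj_on[OF _ inj_on_subset[OF F(2)]])
  then show "\<exists>f. rainbow_embedding f H G c"
    using F(1) f im inj unfolding rainbow_embedding_def subgraph_def bij_betw_def comp_def
    by (intro exI[of _ f]) auto
next
  assume "\<exists>f. rainbow_embedding f H G c"
  then obtain f where inj: "inj_on f (verts H)" and f: "f ` verts H \<subseteq> verts G"
    "\<And>e. e \<in> edges H \<Longrightarrow> f ` e \<in> edges G" and c: "inj_on (\<lambda>e. c (f ` e)) (edges H)"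
    unfolding rainbow_embedding_def by blast
  have sub: "e \<subseteq> verts H" "card e = 2" if "e \<in> edges H" for e
    using H that by (auto simp: simple_graph_def)
  let ?F = "(f ` verts H, (`) f ` edges H)"
  have "card (f ` e) = 2" if "e \<in> edges H" for e
    using sub[OF that] inj by (simp add: card_image inj_on_subset)
  then have "simple_graph ?F"
    using H sub by (auto simp: simple_graph_def)
  then have "subgraph ?F G" using f by (auto simp: subgraph_def)
  moreover have "{u, v} \<in> edges H \<longleftrightarrow> {f u, f v} \<in> (`) f ` edges H"
    if uv: "u \<in> verts H" "v \<in> verts H" for u v
  proof
    assume "{u, v} \<in> edges H"
    then have "f ` {u, v} \<in> (`) f ` edges H" by (rule imageI)
    then show "{f u, f v} \<in> (`) f ` edges H" by simp
  next
    assume "{f u, f v} \<in> (`) f ` edges H"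
    then obtain e where e: "e \<in> edges H" "f ` {u, v} = f ` e" by auto
    then have "{u, v} = e" using inj_on_image_eq_iff[OF inj, of "{u, v}" e] uv sub by simp
    then show "{u, v} \<in> edges H" using e by simp
  qed
  then have "graph_iso H ?F"
    unfolding graph_iso_def using inj by (intro exI[of _ f]) (simp add: bij_betw_def)
  moreover have "inj_on c (edges ?F)" using c by (auto simp: inj_on_def)
  ultimately show "has_rainbow_copy H G c" unfolding has_rainbow_copy_def by blast
qed

section \<open>Monotonicity, greedy completion and edge counts\<close>

lemma has_rainbow_copy_mono:
  assumes "simple_graph H" "has_rainbow_copy H G c" "verts G \<subseteq> verts G'" "edges G \<subseteq> edges G'"
    "\<And>e. e \<in> edges G \<Longrightarrow> c e = c' e"
  shows "has_rainbow_copy H G' c'"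
proof -
  obtain f where f: "rainbow_embedding f H G c"
    using assms has_rainbow_copy_iff by metis
  then have "inj_on (\<lambda>e. c' (f ` e)) (edges H)"
    using assms(5) by (auto simp: rainbow_embedding_def inj_on_def)
  then have "rainbow_embedding f H G' c'"
    using f assms(3,4) unfolding rainbow_embedding_def by blast
  then show ?thesis using assms has_rainbow_copy_iff by metis
qed

text \<open>An unsaturated graph has a non-edge and a colour that create no rainbow copy. Adding it
  preserves the hypotheses and shrinks the finite set of vertex subsets that are not edges.\<close>

lemma rainbow_saturated_extension:
  assumes "simple_graph H" "edge_coloured_graph t G c" "\<not> has_rainbow_copy H G c"
  obtains G' c' where "verts G' = verts G" "edges G \<subseteq> edges G'" "\<And>e. e \<in> edges G \<Longrightarrow> c' e = c e"
    "rainbow_saturated t H G' c'"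
proof -
  have "\<exists>G' c'. verts G' = verts G \<and> edges G \<subseteq> edges G' \<and> (\<forall>e\<in>edges G. c' e = c e) \<and>
      rainbow_saturated t H G' c'"
    using assms(2,3)
  proof (induction "card (Pow (verts G) - edges G)" arbitrary: G c rule: less_induct)
    case less
    show ?case
    proof (cases "rainbow_saturated t H G c")
      case False
      then obtain u v i where uv: "u \<in> verts G" "v \<in> verts G" "u \<noteq> v" "{u, v} \<notin> edges G"
        and i: "i \<in> {1..t}"
        and no: "\<not> has_rainbow_copy H (verts G, insert {u, v} (edges G)) (c({u, v} := i))"
        using less.prems unfolding rainbow_saturated_def by blast
      let ?G = "(verts G, insert {u, v} (edges G))"
      have fin: "finite (verts G)"
        using less.prems by (simp add: edge_coloured_graph_def simple_graph_def)
      have "card (Pow (verts ?G) - edges ?G) < card (Pow (verts G) - edges G)"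
        using uv fin by (intro psubset_card_mono) auto
      moreover have "edge_coloured_graph t ?G (c({u, v} := i))"
        using less.prems uv i by (auto simp: edge_coloured_graph_def simple_graph_def)
      ultimately obtain G' c' where "verts G' = verts ?G" "edges ?G \<subseteq> edges G'"
        "\<forall>e\<in>edges ?G. c' e = (c({u, v} := i)) e" "rainbow_saturated t H G' c'"
        using less.hyps no by blast
      then show ?thesis using uv by (intro exI[of _ G'] exI[of _ c']) auto
    qed blast
  qed
  then show thesis using that by blast
qed

lemma sat_le:
  fixes G :: "nat graph"
  assumes "rainbow_saturated t H G c" "card (verts G) = n"
  shows "sat t n H \<le> card (edges G)"
proof -
  have "card (edges G) \<in> {card (edges G) | (G :: nat graph) c.
     card (verts G) = n \<and> rainbow_saturated t H G c}" using assms by blast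
  then show ?thesis unfolding sat_def by (rule cInf_lower) simp
qed

lemma card_edges_le:
  assumes G: "simple_graph G" and C: "C \<subseteq> verts G" and hit: "\<And>e. e \<in> edges G \<Longrightarrow> e \<inter> C \<noteq> {}"
  shows "card (edges G) \<le> card C * card (verts G)"
proof -
  have fin: "finite (verts G)" using G by (simp add: simple_graph_def)
  have "edges G \<subseteq> (\<lambda>(u, v). {u, v}) ` (C \<times> verts G)"
  proof
    fix e assume e: "e \<in> edges G"
    obtain u v where uv: "e = {u, v}" "u \<in> verts G" "v \<in> verts G"
      by (rule simple_graph_edgeE[OF G e])
    with hit[OF e] show "e \<in> (\<lambda>(u, v). {u, v}) ` (C \<times> verts G)"
      by (auto simp: image_iff)
  qed
  moreover have "finite (C \<times> verts G)" using fin C by (auto intro: finite_subset)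
  ultimately have "card (edges G) \<le> card (C \<times> verts G)"
    by (meson card_image_le card_mono finite_imageI le_trans)
  then show ?thesis by (simp add: card_cartesian_product)
qed

lemma ex_bit_neq_nat:
  fixes x y :: nat
  assumes "x < 2 ^ L" "y < 2 ^ L" "x \<noteq> y"
  obtains s where "s < L" "bit x s \<noteq> bit y s"
proof -
  obtain s where s: "bit x s \<noteq> bit y s" using assms(3) by (auto simp: bit_eq_iff)
  have "take_bit L x = x" "take_bit L y = y" using assms by (auto simp: take_bit_nat_eq_self)
  with s have "s < L" by (metis bit_take_bit_iff)
  with s that show thesis by blast
qed

section \<open>Degrees and the choice of the edge ab\<close>

definition degree :: "'a graph \<Rightarrow> 'a \<Rightarrow> nat" where
  "degree G v = card {e \<in> edges G. v \<in> e}"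

lemma degree_eq_0_outside: "simple_graph G \<Longrightarrow> v \<notin> verts G \<Longrightarrow> degree G v = 0"
  unfolding degree_def simple_graph_def by (subst card_eq_0_iff) blast

lemma edge_at_reachable_vertex:
  assumes "(u, w) \<in> {(x, y). {x, y} \<in> E}\<^sup>*" "u \<noteq> w"
  shows "\<exists>e\<in>E. w \<in> e"
proof -
  obtain v where "(v, w) \<in> {(x, y). {x, y} \<in> E}" using assms by (metis rtranclE)
  then show ?thesis by auto
qed

text \<open>Take \<open>a\<close> of maximum degree. If every edge at a neighbour of
  \<open>a\<close> contained \<open>a\<close>, connectivity would make \<open>H\<close> a star
  centred at \<open>a\<close>, which has no cycle. So some neighbour \<open>b\<close> lies on an
  edge avoiding \<open>a\<close>, and counting that edge as well beats the maximum degree.\<close>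

lemma dominating_edge:
  assumes H: "simple_graph H" "connected_graph H" "contains_cycle H"
  obtains a b where "{a, b} \<in> edges H" "a \<noteq> b"
    "\<And>v. degree H v < card {e \<in> edges H. a \<in> e \<or> b \<in> e}"
proof -
  have fin: "finite (verts H)" "verts H \<noteq> {}"
    using H by (auto simp: simple_graph_def connected_graph_def)
  have "Max (degree H ` verts H) \<in> degree H ` verts H" using fin by (intro Max_in) auto
  then obtain a where a: "a \<in> verts H" "degree H a = Max (degree H ` verts H)" by auto
  have max: "degree H v \<le> degree H a" for v
    using a fin degree_eq_0_outside[OF H(1), of v] by (cases "v \<in> verts H") auto
  have "\<exists>b e. {a, b} \<in> edges H \<and> e \<in> edges H \<and> b \<in> e \<and> a \<notin> e"
  proof (rule ccontr)
    assume none: "\<not> ?thesis"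
    have star: "a \<in> e" if e: "e \<in> edges H" for e
    proof -
      obtain p q where pq: "e = {p, q}" "p \<in> verts H" by (rule simple_graph_edgeE[OF H(1) e])
      have "(a, p) \<in> {(x, y). {x, y} \<in> edges H}\<^sup>*"
        using H(2) a pq by (auto simp: connected_graph_def)
      then have "p = a \<or> {a, p} \<in> edges H"
      proof (induction rule: rtrancl_induct)
        case (step y z)
        then have yz: "{y, z} \<in> edges H" by simp
        from step.IH show ?case
        proof
          assume "{a, y} \<in> edges H"
          then have "a \<in> {y, z}" using none yz by blast
          then show ?thesis using yz by auto
        qed (use yz in simp)
      qed simp
      then show ?thesis using none e pq by blast
    qed
    obtain vs where vs: "length vs \<ge> 3" "distinct vs"
      and ed: "\<And>i. i < length vs \<Longrightarrow> {vs ! i, vs ! (Suc i mod length vs)} \<in> edges H"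
      using H(3) unfolding contains_cycle_def by blast
    let ?k = "length vs"
    have "0 < ?k" "1 < ?k" "2 < ?k" "?k - 1 < ?k" "Suc (?k - 1) = ?k" using vs(1) by linarith+
    note k = this
    \<comment> \<open>No vertex lies on all three of these cycle edges; in a triangle the last
      vertex is \<open>vs ! 2\<close>.\<close>
    have "a \<in> {vs ! 0, vs ! 1}" "a \<in> {vs ! 1, vs ! 2}" "a \<in> {vs ! (?k - 1), vs ! 0}"
      using star[OF ed[of 0]] star[OF ed[of 1]] star[OF ed[of "?k - 1"]] k
      by (simp_all add: numeral_2_eq_2)
    moreover have "vs ! 0 \<noteq> vs ! 1" "vs ! 1 \<noteq> vs ! 2" "vs ! 0 \<noteq> vs ! 2" "vs ! 1 \<noteq> vs ! (?k - 1)"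
      using vs k by (subst nth_eq_iff_index_eq; simp)+
    ultimately show False by auto
  qed
  then obtain b e where b: "{a, b} \<in> edges H" and e: "e \<in> edges H" "b \<in> e" "a \<notin> e" by blast
  have "a \<noteq> b" using H(1) b by (auto simp: simple_graph_def)
  moreover have "degree H a < card {e \<in> edges H. a \<in> e \<or> b \<in> e}"
    unfolding degree_def using e finite_edges[OF H(1)] by (intro psubset_card_mono) auto
  ultimately show thesis using that b max le_less_trans by blast
qed

section \<open>The block graph and its colouring\<close>

locale rainbow_blocks =
  fixes H :: "'a graph" and a b :: 'a and idx :: "'a set \<Rightarrow> nat" and n L K :: nat
    and role :: "nat \<Rightarrow> 'a" and kind pos :: "nat \<Rightarrow> nat"
  assumes H: "simple_graph H" and ab: "{a, b} \<in> edges H"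
    and cover: "\<And>v. v \<in> verts H \<Longrightarrow> \<exists>e\<in>edges H. v \<in> e"
    and deg: "\<And>v. degree H v < card {e \<in> edges H. a \<in> e \<or> b \<in> e}"
    and idx: "bij_betw idx (edges H) {1..card (edges H)}" and idx_ab: "idx {a, b} = 1"
    and blocks: "bij_betw (\<lambda>u. (role u, kind u, pos u)) {..<K}
        ((verts H - {a, b}) \<times> {1..card (edges H)} \<times> {..<L})"
    and K_le: "K \<le> n" and n_le: "n \<le> 2 ^ L"
begin

text \<open>Core vertices are those below \<open>K\<close>; \<open>local_role s v\<close> is the vertex of \<open>H\<close> that \<open>v\<close> stands for
  from the point of view of a block at bit position \<open>s\<close>.\<close>

definition local_role :: "nat \<Rightarrow> nat \<Rightarrow> 'a" where
  "local_role s v = (if v < K then role v else if bit v s then a else b)"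

text \<open>Oriented: \<open>u\<close> is a core vertex, and its block fixes the bit position at
  which an outer \<open>v\<close> is read.\<close>

definition joined :: "nat \<Rightarrow> nat \<Rightarrow> bool" where
  "joined u v \<longleftrightarrow> u < K \<and> v < n \<and> (v < K \<longrightarrow> kind v = kind u \<and> pos v = pos u) \<and>
     {role u, local_role (pos u) v} \<in> edges H"

text \<open>For \<open>i\<close> in 1..m, the edges of \<open>H\<close> other than
  \<open>{a, b}\<close> receive under \<open>shade i\<close> each colour of 1..m except
  \<open>i\<close> exactly once; this includes \<open>i = 1\<close>, where nothing is
  recoloured.\<close>

definition shade :: "nat \<Rightarrow> 'a set \<Rightarrow> nat" where
  "shade i e = (if idx e = i then 1 else idx e)"

definition block_graph :: "nat graph" where
  "block_graph = ({..<n}, {{u, v} | u v. joined u v})"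

definition colour :: "nat set \<Rightarrow> nat" where
  "colour e = (SOME k. \<exists>u v. e = {u, v} \<and> joined u v \<and>
     k = shade (kind u) {role u, local_role (pos u) v})"

text \<open>The choice in \<open>colour\<close> is harmless: an edge to an outer vertex can be read
  in one direction only, and both readings of an edge inside a block give the same block and the
  same pair of roles.\<close>

lemma colour_eq:
  assumes "joined u v"
  shows "colour {u, v} = shade (kind u) {role u, local_role (pos u) v}"
  unfolding colour_def
proof (rule some_equality)
  fix k assume "\<exists>u' v'. {u, v} = {u', v'} \<and> joined u' v' \<and>
    k = shade (kind u') {role u', local_role (pos u') v'}"
  then obtain u' v' where eq: "{u, v} = {u', v'}" and uv': "joined u' v'"
    and k: "k = shade (kind u') {role u', local_role (pos u') v'}" by blast
  consider "u' = u" "v' = v" | "u' = v" "v' = u" using eq by (metis doubleton_eq_iff)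
  then show "k = shade (kind u) {role u, local_role (pos u) v}"
  proof cases
    case 2
    have "v < K" "u < K" using assms uv' 2 unfolding joined_def by auto
    moreover from this have "kind v = kind u" "pos v = pos u" using assms unfolding joined_def by auto
    ultimately show ?thesis using k 2 by (simp add: local_role_def insert_commute)
  qed (use k in simp)
next
  show "\<exists>u' v'. {u, v} = {u', v'} \<and> joined u' v' \<and> shade (kind u) {role u, local_role (pos u) v} =
      shade (kind u') {role u', local_role (pos u') v'}"
    using assms by (intro exI[of _ u] exI[of _ v]) simp
qed

lemma a_neq_b: "a \<noteq> b"
  using card_edge[OF H ab] by auto

lemma role_mem: "u < K \<Longrightarrow> role u \<in> verts H - {a, b}"
  using bij_betwE[OF blocks] by auto

lemma joined_neq:
  assumes "joined u v"
  shows "u \<noteq> v"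
  using assms card_edge[OF H, of "{role u, local_role (pos u) v}"]
  by (auto simp: joined_def local_role_def)

lemma idx_mem: "e \<in> edges H \<Longrightarrow> idx e \<in> {1..card (edges H)}"
  using idx by (auto simp: bij_betw_def)

lemma idx_inj: "e \<in> edges H \<Longrightarrow> e' \<in> edges H \<Longrightarrow> idx e = idx e' \<longleftrightarrow> e = e'"
  using idx by (auto simp: bij_betw_def inj_on_def)

lemma shade_mem: "e \<in> edges H \<Longrightarrow> shade i e \<in> {1..card (edges H)}"
  using idx_mem[of e] by (auto simp: shade_def)

lemma edge_coloured:
  assumes t: "card (edges H) \<le> t"
  shows "edge_coloured_graph t block_graph colour"
proof -
  have "e \<subseteq> {..<n} \<and> card e = 2 \<and> colour e \<in> {1..t}" if e: "e \<in> edges block_graph" for e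
  proof -
    obtain u v where uv: "e = {u, v}" "joined u v" using e by (auto simp: block_graph_def)
    have "colour e \<in> {1..card (edges H)}"
      unfolding uv(1) colour_eq[OF uv(2)] using uv(2) by (intro shade_mem) (simp add: joined_def)
    then show ?thesis
      using uv joined_neq[OF uv(2)] K_le t by (simp add: joined_def)
  qed
  then show ?thesis
    by (simp add: edge_coloured_graph_def simple_graph_def) (simp add: block_graph_def)
qed

section \<open>Absence of rainbow copies\<close>

lemma no_rainbow_copy: "\<not> has_rainbow_copy H block_graph colour"
proof
  let ?m = "card (edges H)"
  assume "has_rainbow_copy H block_graph colour"
  then obtain f where "rainbow_embedding f H block_graph colour"
    using has_rainbow_copy_iff[OF H] by blast
  then have inj: "inj_on f (verts H)"
    and fE: "\<And>e. e \<in> edges H \<Longrightarrow> f ` e \<in> edges block_graph"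
    and c: "inj_on (\<lambda>e. colour (f ` e)) (edges H)"
    unfolding rainbow_embedding_def by blast+
  have sub: "e \<subseteq> verts H" if "e \<in> edges H" for e
    using H that by (auto simp: simple_graph_def)
  have finV: "finite (verts H)" using H by (simp add: simple_graph_def)
  have im: "\<exists>u v. f ` e = {u, v} \<and> joined u v" if "e \<in> edges H" for e
    using fE[OF that] by (auto simp: block_graph_def)
  have "(\<lambda>e. colour (f ` e)) ` edges H \<subseteq> {1..?m}"
  proof safe
    fix e assume "e \<in> edges H"
    then obtain u v where uv: "f ` e = {u, v}" "joined u v" using im by blast
    then show "colour (f ` e) \<in> {1..?m}"
      using shade_mem by (simp only: colour_eq) (simp add: joined_def)
  qed
  then have "(\<lambda>e. colour (f ` e)) ` edges H = {1..?m}"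
    using card_image[OF c] by (intro card_subset_eq) auto
  \<comment> \<open>All m colours occur, so \<open>g e\<close> can be taken to be the edge of
    \<open>H\<close> whose image has colour \<open>idx e\<close>.\<close>
  then have "\<forall>e\<in>edges H. \<exists>e'\<in>edges H. colour (f ` e') = idx e"
    using idx_mem by (metis (no_types, lifting) imageE)
  then obtain g where g: "\<And>e. e \<in> edges H \<Longrightarrow> g e \<in> edges H"
    and cg: "\<And>e. e \<in> edges H \<Longrightarrow> colour (f ` g e) = idx e" by metis
  \<comment> \<open>A colour other than 1 is never the result of recolouring, so it reveals the role
    and excludes one kind.\<close>
  have gen: "\<exists>u v. f ` g e = {u, v} \<and> joined u v \<and> {role u, local_role (pos u) v} = e \<and> kind u \<noteq> idx e"
    if e: "e \<in> edges H" "e \<noteq> {a, b}" for e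
  proof -
    obtain u v where uv: "f ` g e = {u, v}" "joined u v" using im g e by blast
    let ?r = "{role u, local_role (pos u) v}"
    have r: "?r \<in> edges H" using uv by (simp add: joined_def)
    have "shade (kind u) ?r = idx e" using cg[OF e(1)] uv colour_eq by simp
    moreover have "idx e \<noteq> 1" using idx_inj[OF e(1) ab] idx_ab e(2) by simp
    ultimately have "idx ?r = idx e" "kind u \<noteq> idx e" unfolding shade_def by metis+
    then show ?thesis using uv idx_inj[OF r e(1)] by blast
  qed
  \<comment> \<open>Colour 1 is the index of \<open>{a, b}\<close>, which is never a role. So the
    edge of colour 1 is recoloured: it has some role \<open>e0\<close> and lies in a block of kind
    \<open>idx e0\<close>. By \<open>gen\<close>, role \<open>e0\<close> also occurs in a block of
    another kind.\<close>
  obtain u0 v0 where uv0: "f ` g {a, b} = {u0, v0}" "joined u0 v0" using im g ab by blast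
  define e0 where "e0 = {role u0, local_role (pos u0) v0}"
  have e0: "e0 \<in> edges H" using uv0 by (simp add: joined_def e0_def)
  have u0: "u0 < K" using uv0 by (simp add: joined_def)
  have e0_ab: "e0 \<noteq> {a, b}" using role_mem[OF u0] unfolding e0_def by blast
  have "shade (kind u0) e0 = 1" using cg[OF ab] uv0 colour_eq idx_ab by (simp add: e0_def)
  moreover have "idx e0 \<noteq> 1" using idx_inj[OF e0 ab] idx_ab e0_ab by simp
  ultimately have kind0: "kind u0 = idx e0" unfolding shade_def by metis
  define W where "W = f ` verts H"
  have finW: "finite W" and cardW: "card W = card (verts H)"
    using finV inj by (auto simp: W_def card_image)
  have gW: "f ` g e \<subseteq> W" if "e \<in> edges H" for e
    using sub[OF g[OF that]] by (auto simp: W_def)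
  \<comment> \<open>Look for \<open>w\<close> on the image of \<open>g e\<close>, with
    \<open>e = e0\<close> whenever \<open>w\<close> lies on \<open>e0\<close>. The core vertex found
    cannot be \<open>u0\<close> or \<open>v0\<close>: its role would then lie on \<open>e0\<close>,
    forcing \<open>e = e0\<close>, but its kind differs from \<open>idx e\<close>.\<close>
  have "verts H - {a, b} \<subseteq> role ` (W \<inter> {..<K} - {u0, v0})"
  proof
    fix w assume w: "w \<in> verts H - {a, b}"
    then obtain e' where "e' \<in> edges H" "w \<in> e'" using cover by auto
    then obtain e where e: "e \<in> edges H" "w \<in> e" "w \<in> e0 \<Longrightarrow> e = e0"
      using e0 by metis
    then have "e \<noteq> {a, b}" using w by blast
    then obtain u v where uv: "f ` g e = {u, v}" "joined u v"
      "{role u, local_role (pos u) v} = e" "kind u \<noteq> idx e" using gen e by blast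
    have "\<exists>y\<in>{u, v}. y < K \<and> role y = w \<and> kind y \<noteq> idx e"
    proof (cases "w = role u")
      case True
      then show ?thesis using uv by (auto simp: joined_def)
    next
      case False
      then have "local_role (pos u) v = w" using uv(3) e(2) by blast
      then have "v < K" "role v = w" using w by (auto simp: local_role_def split: if_splits)
      then show ?thesis using uv(2,4) unfolding joined_def by auto
    qed
    then obtain y where y: "y \<in> {u, v}" "y < K" "role y = w" "kind y \<noteq> idx e" by blast
    have "y \<in> W" using y(1) uv(1) gW[OF e(1)] by auto
    moreover have "y \<notin> {u0, v0}"
    proof
      assume "y \<in> {u0, v0}"
      then have "kind y = kind u0" "role y \<in> e0"
        using y(2) uv0(2) unfolding joined_def e0_def local_role_def by auto
      then show False using y(3,4) e(3) kind0 by metis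
    qed
    ultimately show "w \<in> role ` (W \<inter> {..<K} - {u0, v0})" using y by blast
  qed
  then have "card (verts H - {a, b}) \<le> card (W \<inter> {..<K} - {u0, v0})"
    by (rule surj_card_le[rotated]) (simp add: finW)
  moreover have "card (verts H - {a, b}) = card (verts H) - 2"
    using sub[OF ab] a_neq_b by (subst card_Diff_subset) auto
  ultimately have core: "card (verts H) - 2 \<le> card (W \<inter> {..<K} - {u0, v0})" by simp
  have outer: "f ` g e \<inter> {K..} \<noteq> {}" if e: "e \<in> edges H" "e \<noteq> {a, b}" "a \<in> e \<or> b \<in> e" for e
  proof -
    obtain u v where uv: "f ` g e = {u, v}" "joined u v" "{role u, local_role (pos u) v} = e"
      using gen e by blast
    then have "u < K" by (simp add: joined_def)
    then have "\<not> v < K"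
      using role_mem[of u] role_mem[of v] uv(3) e(3) unfolding local_role_def by (cases "v < K") auto
    then show ?thesis using uv(1) by auto
  qed
  have uvW: "{u0, v0} \<subseteq> W" using gW[OF ab] uv0(1) by simp
  have two: "2 \<le> card (verts H)"
    using card_mono[OF finV sub[OF ab]] a_neq_b by simp
  \<comment> \<open>Otherwise \<open>{a, b}\<close> would be the only edge meeting \<open>a\<close>
    or \<open>b\<close>, against \<open>deg\<close> at \<open>a\<close>.\<close>
  have "\<exists>e\<in>edges H. e \<noteq> {a, b} \<and> (a \<in> e \<or> b \<in> e)"
  proof (rule ccontr)
    assume "\<not> ?thesis"
    then have "{e \<in> edges H. a \<in> e \<or> b \<in> e} = {e \<in> edges H. a \<in> e}" by auto
    then show False using deg[of a] by (simp add: degree_def)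
  qed
  then obtain x where x: "x \<in> W \<inter> {K..}" using outer gW by blast
  \<comment> \<open>The three parts have at least |H| - 2, 1 and 1 elements, while \<open>W\<close>
    has |H|, so all three bounds are attained.\<close>
  have split: "card W = card (W \<inter> {..<K} - {u0, v0}) + card ({u0, v0} \<inter> {..<K}) + card (W \<inter> {K..})"
  proof -
    let ?A = "W \<inter> {..<K} - {u0, v0}" and ?B = "{u0, v0} \<inter> {..<K}" and ?C = "W \<inter> {K..}"
    have "W = ?A \<union> ?B \<union> ?C" using uvW by auto
    moreover have "card (?A \<union> ?B \<union> ?C) = card (?A \<union> ?B) + card ?C"
      using finW by (intro card_Un_disjoint) auto
    moreover have "card (?A \<union> ?B) = card ?A + card ?B"
      using finW by (intro card_Un_disjoint) auto
    ultimately show ?thesis by metis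
  qed
  have "card ({u0, v0} \<inter> {..<K}) \<ge> 1" "card (W \<inter> {K..}) \<ge> 1"
    using u0 x finW by (auto simp: Suc_le_eq card_gt_0_iff)
  then have one: "card (W \<inter> {K..}) = 1" "card ({u0, v0} \<inter> {..<K}) = 1"
    using split core cardW two by linarith+
  then have outer_x: "W \<inter> {K..} = {x}" using x by (metis card_1_singletonE singletonD)
  have "\<not> v0 < K"
  proof
    assume "v0 < K"
    then have "{u0, v0} \<inter> {..<K} = {u0, v0}" using u0 by auto
    then show False using one(2) joined_neq[OF uv0(2)] by simp
  qed
  then have "v0 \<in> W \<inter> {K..}" using uvW by simp
  then have v0: "v0 = x" unfolding outer_x by simp
  obtain z where z: "z \<in> verts H" "x = f z" using x by (auto simp: W_def)
  let ?D = "{e \<in> edges H. a \<in> e \<or> b \<in> e}"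
  \<comment> \<open>Every image in question meets the outer vertices, hence contains the only one,
    \<open>x\<close>; for \<open>{a, b}\<close> this is because \<open>v0 = x\<close>. So
    \<open>z\<close> has at least as many edges as \<open>?D\<close>.\<close>
  have "g ` ?D \<subseteq> {e \<in> edges H. z \<in> e}"
  proof (rule image_subsetI)
    fix e assume "e \<in> ?D"
    then have e: "e \<in> edges H" and D: "a \<in> e \<or> b \<in> e" by simp_all
    have "x \<in> f ` g e"
    proof (cases "e = {a, b}")
      case True then show ?thesis using uv0 v0 by simp
    next
      case False
      then obtain y where "y \<in> f ` g e" "y \<in> W \<inter> {K..}" using outer[OF e _ D] gW[OF e] by blast
      then show ?thesis unfolding outer_x by simp
    qed
    then have "z \<in> g e" using z inj_on_image_mem_iff[OF inj z(1) sub[OF g[OF e]]] by simp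
    then show "g e \<in> {e \<in> edges H. z \<in> e}" using g[OF e] by simp
  qed
  moreover have "inj_on g ?D"
  proof (rule inj_onI)
    fix e e' assume e: "e \<in> ?D" "e' \<in> ?D" and "g e = g e'"
    then have "idx e = idx e'" using cg[of e] cg[of e'] by simp
    then show "e = e'" using idx_inj[of e e'] e by simp
  qed
  ultimately have "card ?D \<le> degree H z"
    unfolding degree_def using finite_edges[OF H] by (intro card_inj_on_le[of g]) auto
  then show False using deg[of z] by simp
qed

section \<open>Outer pairs and the bound by the core size\<close>

lemma outer_pair_completes:
  assumes i: "i \<ge> 1" and x: "K \<le> x" "x < n" and y: "K \<le> y" "y < n"
    and s: "s < L" "bit x s" "\<not> bit y s"
  shows "has_rainbow_copy H (verts block_graph, insert {x, y} (edges block_graph)) (colour({x, y} := i))"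
proof -
  let ?m = "card (edges H)"
  \<comment> \<open>Colours above m occur in no block, so any kind serves for them.\<close>
  define j where "j = (if i \<le> ?m then i else 1)"
  have "?m \<ge> 1" using finite_edges[OF H] ab by (auto simp: Suc_le_eq card_gt_0_iff)
  then have j: "j \<in> {1..?m}" using i by (auto simp: j_def)
  have "\<exists>u<K. role u = w \<and> kind u = j \<and> pos u = s" if "w \<in> verts H - {a, b}" for w
  proof -
    have "(w, j, s) \<in> (\<lambda>u. (role u, kind u, pos u)) ` {..<K}"
      using that j s(1) blocks by (simp add: bij_betw_def)
    then show ?thesis by auto
  qed
  then obtain F where F: "\<And>w. w \<in> verts H - {a, b} \<Longrightarrow>
      F w < K \<and> role (F w) = w \<and> kind (F w) = j \<and> pos (F w) = s" by metis
  define f where "f w = (if w = a then x else if w = b then y else F w)" for w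
  \<comment> \<open>Bit \<open>s\<close> makes \<open>x\<close> read as \<open>a\<close> and
    \<open>y\<close> as \<open>b\<close>, so \<open>local_role s\<close> undoes \<open>f\<close> on
    the vertices of \<open>H\<close>.\<close>
  have lr: "local_role s (f w) = w" "f w < n" if "w \<in> verts H" for w
    using that F[of w] x y s K_le by (auto simp: f_def local_role_def)
  have inj: "inj_on f (verts H)" using lr(1) by (metis inj_onI)
  have fe: "f ` e \<in> edges block_graph \<and> colour (f ` e) = shade j e \<and> f ` e \<noteq> {x, y}"
    if e: "e \<in> edges H" "e \<noteq> {a, b}" for e
  proof -
    obtain p' q' where pq': "e = {p', q'}" "p' \<noteq> q'" "p' \<in> verts H" "q' \<in> verts H"
      by (rule simple_graph_edgeE[OF H e(1)])
    \<comment> \<open>An endpoint outside \<open>{a, b}\<close> comes first, since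
      \<open>joined\<close> expects a core vertex there.\<close>
    obtain p q where pq: "e = {p, q}" "p \<in> verts H - {a, b}" "q \<in> verts H"
    proof (cases "p' \<in> {a, b}")
      case True
      then have "q' \<notin> {a, b}" using pq'(1,2) e(2) by blast
      then show ?thesis using that[of q' p'] pq' by (simp add: insert_commute)
    next
      case False
      then show ?thesis using that[of p' q'] pq' by simp
    qed
    have fp: "f p = F p" using pq by (simp add: f_def)
    have "joined (f p) (f q)"
      unfolding joined_def using F[of p] F[of q] pq lr[of q] x y e by (auto simp: fp f_def)
    moreover have "{role (f p), local_role (pos (f p)) (f q)} = e" "kind (f p) = j"
      using F[of p] pq lr[of q] by (auto simp: fp)
    moreover have "f p \<noteq> x" "f p \<noteq> y" using F[OF pq(2)] x y fp by auto
    ultimately show ?thesis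
      using colour_eq[of "f p" "f q"] pq(1) by (auto simp: block_graph_def)
  qed
  have fab: "f ` {a, b} = {x, y}" using a_neq_b by (auto simp: f_def)
  let ?c = "colour({x, y} := i)"
  have nab: "idx e \<noteq> 1" if "e \<in> edges H" "e \<noteq> {a, b}" for e
    using idx_inj[OF that(1) ab] idx_ab that(2) by simp
  have cE: "?c (f ` e) = (if e = {a, b} then i else shade j e)" if "e \<in> edges H" for e
    using fe[OF that] fab by auto
  have fresh: "shade j e \<noteq> i" if "e \<in> edges H" "e \<noteq> {a, b}" for e
    using nab[OF that] idx_mem[OF that(1)] \<open>?m \<ge> 1\<close> by (auto simp: shade_def j_def)
  have shade_inj: "e = e'" if "e \<in> edges H" "e \<noteq> {a, b}" "e' \<in> edges H" "e' \<noteq> {a, b}"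
    "shade j e = shade j e'" for e e'
    using that(5) nab[OF that(1,2)] nab[OF that(3,4)] idx_inj[OF that(1,3)]
    unfolding shade_def by metis
  have "inj_on (\<lambda>e. ?c (f ` e)) (edges H)"
  proof (rule inj_onI)
    fix e e' assume e: "e \<in> edges H" "e' \<in> edges H" and eq: "?c (f ` e) = ?c (f ` e')"
    show "e = e'"
      using eq[unfolded cE[OF e(1)] cE[OF e(2)]] fresh[OF e(1)] fresh[OF e(2)] shade_inj[OF e(1) _ e(2)]
      by (metis (full_types))
  qed
  moreover have "f ` e \<in> insert {x, y} (edges block_graph)" if "e \<in> edges H" for e
    using fe[OF that] fab by auto
  ultimately have "rainbow_embedding f H (verts block_graph, insert {x, y} (edges block_graph)) ?c"
    using inj lr(2) by (auto simp: rainbow_embedding_def block_graph_def)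
  then show ?thesis using has_rainbow_copy_iff[OF H] by blast
qed

lemma sat_le_core:
  assumes t: "card (edges H) \<le> t"
  shows "sat t n H \<le> K * n"
proof -
  obtain G c where G: "verts G = verts block_graph" "edges block_graph \<subseteq> edges G"
    "\<And>e. e \<in> edges block_graph \<Longrightarrow> c e = colour e" and sat: "rainbow_saturated t H G c"
    using rainbow_saturated_extension[OF H edge_coloured[OF t] no_rainbow_copy] by metis
  have V: "verts G = {..<n}" using G by (simp add: block_graph_def)
  have sG: "simple_graph G" and cG: "\<And>e. e \<in> edges G \<Longrightarrow> c e \<in> {1..t}"
    and no: "\<not> has_rainbow_copy H G c"
    using sat by (auto simp: rainbow_saturated_def edge_coloured_graph_def)
  have hit: "e \<inter> {..<K} \<noteq> {}" if e: "e \<in> edges G" for e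
  proof
    assume out: "e \<inter> {..<K} = {}"
    obtain x y where xy: "e = {x, y}" "x \<noteq> y" "x < n" "y < n"
      by (rule simple_graph_edgeE[OF sG e]) (simp add: V)
    obtain s where s: "s < L" "bit x s \<noteq> bit y s"
      using ex_bit_neq_nat[of x L y] xy n_le by (metis less_le_trans)
    \<comment> \<open>The edge \<open>e\<close> is put into the block graph with the colour it has
      in \<open>G\<close>; the result is part of \<open>G\<close>. Which end plays \<open>a\<close>
      depends on which has bit \<open>s\<close>.\<close>
    have "has_rainbow_copy H (verts block_graph, insert {x, y} (edges block_graph)) (colour({x, y} := c e))"
      using outer_pair_completes[of "c e" x y s] outer_pair_completes[of "c e" y x s] xy s out cG[OF e]
      by (auto simp: insert_commute not_less)
    then have "has_rainbow_copy H G c"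
      by (rule has_rainbow_copy_mono[OF H]) (use G e xy in auto)
    with no show False by simp
  qed
  have "sat t n H \<le> card (edges G)" using sat_le[OF sat] V by simp
  also have "\<dots> \<le> card {..<K} * card (verts G)"
    using K_le V by (intro card_edges_le[OF sG _ hit]) auto
  finally show ?thesis using V by simp
qed

end

section \<open>Choice of parameters\<close>

theorem theorem3p8:
  fixes H :: "'a graph"
  assumes "simple_graph H" and "connected_graph H" and "card (verts H) \<ge> 3"
    and "contains_cycle H"
  shows "\<exists>\<epsilon> :: nat \<Rightarrow> real. \<epsilon> \<longlonglongrightarrow> 0 \<and>
    (\<forall>t n :: nat. t \<ge> card (edges H) \<longrightarrow> n \<ge> 1 \<longrightarrow>
      real (sat t n H) \<le> (1 + \<epsilon> n) * (2 * real (card (edges H)) * (real (card (verts H)) - 2))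
        * (real n * log 2 (real n)))"
proof (intro exI conjI allI impI)
  show "(\<lambda>_ :: nat. 0 :: real) \<longlonglongrightarrow> 0" by simp
next
  fix t n :: nat
  assume t: "t \<ge> card (edges H)" and n: "n \<ge> 1"
  let ?m = "card (edges H)"
  obtain a b where ab: "{a, b} \<in> edges H" "a \<noteq> b"
    and deg: "\<And>v. degree H v < card {e \<in> edges H. a \<in> e \<or> b \<in> e}"
    using dominating_edge[OF assms(1,2,4)] by metis
  have finE: "finite (edges H)" by (rule finite_edges[OF assms(1)])
  have finV: "finite (verts H)" and abV: "{a, b} \<subseteq> verts H"
    using ab(1) assms(1) unfolding simple_graph_def by blast+
  have cover: "\<exists>e\<in>edges H. v \<in> e" if v: "v \<in> verts H" for v
  proof (cases "v = a")
    case False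
    then show ?thesis
      using assms(2) abV v by (intro edge_at_reachable_vertex[of a]) (auto simp: connected_graph_def)
  qed (use ab in auto)
  have "1 \<le> degree H a" unfolding degree_def using ab(1) finE by (auto simp: Suc_le_eq card_gt_0_iff)
  also have "degree H a < card {e \<in> edges H. a \<in> e \<or> b \<in> e}" by (rule deg)
  also have "\<dots> \<le> ?m" using finE by (intro card_mono) auto
  finally have m2: "?m \<ge> 2" by simp
  define L where "L = nat \<lceil>log 2 (real n)\<rceil>"
  have L: "real L \<le> 2 * log 2 (real n)" "n \<le> 2 ^ L"
  proof -
    have "real L = real_of_int \<lceil>log 2 (real n)\<rceil>" using n by (simp add: L_def)
    then have *: "log 2 (real n) \<le> real L" "real L < log 2 (real n) + 1" by linarith+
    \<comment> \<open>The factor 2 in c_H absorbs the rounding: log n + 1 is at most 2 log n for n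
      \<ge> 2, and \<open>L = 0\<close> for n = 1.\<close>
    show "real L \<le> 2 * log 2 (real n)"
    proof (cases "n = 1")
      case False
      then have "log 2 (real n) \<ge> 1" using n by (subst le_log_iff) auto
      then show ?thesis using * by simp
    qed (simp add: L_def)
    have "real n \<le> 2 powr real L" using * n by (simp add: log_le_iff)
    then have "real n \<le> real (2 ^ L)" by (simp add: powr_realpow)
    then show "n \<le> 2 ^ L" by (simp only: of_nat_le_iff)
  qed
  define K where "K = (card (verts H) - 2) * (?m * L)"
  have "sat t n H \<le> K * n"
  proof (cases "K \<le> n")
    case True
    obtain h where h: "bij_betw h (edges H - {{a, b}}) {2..?m}"
      using finite_same_card_bij[of "edges H - {{a, b}}" "{2..?m}"] finE ab by auto
    define idx where "idx e = (if e = {a, b} then 1 else h e)" for e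
    have "bij_betw idx ({{a, b}} \<union> (edges H - {{a, b}})) ({1} \<union> {2..?m})"
      by (rule bij_betw_combine)
        (use h in \<open>auto simp: idx_def bij_betw_def inj_on_def\<close>)
    moreover have "{{a, b}} \<union> (edges H - {{a, b}}) = edges H" "{1} \<union> {2..?m} = {1..?m}"
      using ab m2 by auto
    ultimately have idx: "bij_betw idx (edges H) {1..?m}" by simp
    have "card ((verts H - {a, b}) \<times> {1..?m} \<times> {..<L}) = card {..<K}"
      using abV ab(2) by (simp add: K_def card_cartesian_product card_Diff_subset numeral_2_eq_2)
    then obtain \<beta> where \<beta>: "bij_betw \<beta> {..<K} ((verts H - {a, b}) \<times> {1..?m} \<times> {..<L})"
      using finite_same_card_bij[of "{..<K}" "(verts H - {a, b}) \<times> {1..?m} \<times> {..<L}"] finV by auto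
    interpret rainbow_blocks H a b idx n L K "\<lambda>u. fst (\<beta> u)" "\<lambda>u. fst (snd (\<beta> u))" "\<lambda>u. snd (snd (\<beta> u))"
      by unfold_locales (use assms(1) ab cover deg idx \<beta> True L(2) in \<open>auto simp: idx_def\<close>)
    show ?thesis by (rule sat_le_core[OF t])
  next
    \<comment> \<open>The core does not fit, but then even the trivial bound n * n is below
      \<open>K * n\<close>.\<close>
    case False
    obtain G :: "nat graph" and c where G: "card (verts G) = n" "rainbow_saturated t H G c"
      "card (edges G) = sat t n H"
      using sat_attained[OF assms(1) m2, of t n] t m2 by auto
    then have sG: "simple_graph G" by (simp add: rainbow_saturated_def edge_coloured_graph_def)
    have "card (edges G) \<le> card (verts G) * card (verts G)"
    proof (rule card_edges_le[OF sG subset_refl])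
      fix e assume e: "e \<in> edges G"
      then have "e \<subseteq> verts G" "e \<noteq> {}"
        using sG card_edge[OF sG e] by (auto simp: simple_graph_def)
      then show "e \<inter> verts G \<noteq> {}" by blast
    qed
    also have "\<dots> \<le> K * n" using False G(1) by simp
    finally show ?thesis using G by simp
  qed
  then have "real (sat t n H) \<le> real K * real n" by (metis of_nat_le_iff of_nat_mult)
  also have "real K * real n = (real ?m * (real (card (verts H)) - 2) * real n) * real L"
    using assms(3) by (simp add: K_def of_nat_diff)
  also have "\<dots> \<le> (real ?m * (real (card (verts H)) - 2) * real n) * (2 * log 2 (real n))"
    using L(1) assms(3) by (intro mult_left_mono) auto
  finally show "real (sat t n H) \<le> (1 + 0) * (2 * real ?m * (real (card (verts H)) - 2))
      * (real n * log 2 (real n))" by (simp add: algebra_simps)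
qed

end
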